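(* Let $d\ge 1$. If $G\subseteq\mathbb{T}_{\pm}^d$ is a TC-hemispace and $G\notin\{\emptyset,\mathbb{T}_{\pm}^d\}$, then there exists a vector $a=(a_0,\dots,a_d)\in\mathbb{T}_{\pm}^{d+1}$ with $(a_1,\dots,a_d)\neq(\mathbb{O},\dots,\mathbb{O})$ such that $\mathcal{H}^+(a)\subseteq G\subseteq\overline{\mathcal{H}}^+(a)$.
   Context: Signed tropical numbers. Let $\mathbb{O}=-\infty$ be the tropical zero. $\mathbb{T}_{>\mathbb{O}}=\mathbb{R}$ (positive numbers), $\mathbb{T}_{<\mathbb{O}}=\{\ominus r: r\in\mathbb{R}\}$ (negative numbers), $\mathbb{T}_{\pm}=\mathbb{T}_{>\mathbb{O}}\cup\mathbb{T}_{<\mathbb{O}}\cup\{\mathbb{O}\}$, balanced numbers $\mathbb{T}_{\bullet}=\{\bullet r: r\in\mathbb{R}\}\cup\{\mathbb{O}\}$, symmetrized semiring $\mathbb{S}=\mathbb{T}_{\pm}\cup\mathbb{T}_{\bullet}$. The norm is $|r|=|\ominus r|=|\bullet r|=r$ and $|\mathbb{O}|=\mathbb{O}$; the sign $\mathrm{tsgn}$ takes values in $\{\oplus,\ominus,\bullet,\mathbb{O}\}$. Addition on $\mathbb{S}$: $x\oplus y$ equals $x$ if $|x|>|y|$, $y$ if $|y|>|x|$, $x$ if $|x|=|y|$ and $\mathrm{tsgn}(x)=\mathrm{tsgn}(y)$, and $\bullet|x|$ if $|x|=|y|$ and the signs differ. Multiplication: $x\odot y$ has norm $|x|+|y|$ and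 sign the product of signs (with $\oplus,\ominus,\bullet$ multiplying like $1,-1,0$); $\mathbb{O}$ is absorbing. The multiplicative unit is the real number $0$. Halfspaces. For $a=(a_0,\dots,a_d)\in\mathbb{T}_{\pm}^{d+1}$ with $(a_1,\dots,a_d)\ne(\mathbb{O},\dots,\mathbb{O})$, write $a(x)=a_0\oplus a_1\odot x_1\oplus\dots\oplus a_d\odot x_d$. The open halfspace is $\mathcal{H}^+(a)=\{x\in\mathbb{T}_{\pm}^d: a(x)\in\mathbb{T}_{>\mathbb{O}}\}$ and the closed halfspace is $\overline{\mathcal{H}}^+(a)=\{x\in\mathbb{T}_{\pm}^d: a(x)\in\mathbb{T}_{>\mathbb{O}}\cup\mathbb{T}_{\bullet}\}$. TC-convexity. For $x,y\in\mathbb{T}_{\pm}^d$, $\mathrm{conv}_{TC}(x,y)$ is the intersection of all closed halfspaces $\overline{\mathcal{H}}^+(a)$ containing both $x$ and $y$. A set $X\subseteq\mathbb{T}_{\pm}^d$ is TC-convex if $\mathrm{conv}_{TC}(x,y)\subseteq X$ for all $x,y\in X$. A TC-hemispace is a TC-convex set $X\subseteq\mathbb{T}_{\pm}^d$ whose complement $\mathbb{T}_{\pm}^d\setminus X$ is also TC-convex. *)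

theory Defs
  imports "HOL-Analysis.Finite_Cartesian_Product"
begin

datatype tsign = SPos | SNeg | SBal

fun tsign_mult :: "tsign \<Rightarrow> tsign \<Rightarrow> tsign" where
  "tsign_mult SBal t = SBal"
| "tsign_mult s SBal = SBal"
| "tsign_mult SPos t = t"
| "tsign_mult SNeg SPos = SNeg"
| "tsign_mult SNeg SNeg = SPos"

text \<open>
  The symmetrized tropical semiring: \<open>Elem SPos r\<close>, \<open>Elem SNeg r\<close> and \<open>Elem SBal r\<close> are the
  positive, negative and balanced elements of norm \<open>r\<close>, and \<open>TZero\<close> is the tropical zero, of
  norm minus infinity.
\<close>
datatype symtrop = TZero | Elem tsign real

text \<open>
  In this instance \<open>0\<close> is the tropical zero, and the unit \<open>1\<close> is the positive element
  whose norm is the real number 0.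
\<close>
instantiation symtrop :: comm_semiring_1
begin

definition "0 = TZero"

definition "1 = Elem SPos 0"

fun plus_symtrop :: "symtrop \<Rightarrow> symtrop \<Rightarrow> symtrop" where
  "TZero + y = y"
| "x + TZero = x"
| "Elem s p + Elem t q =
    (if q < p then Elem s p
     else if p < q then Elem t q
     else if s = t then Elem s p
     else Elem SBal p)"

fun times_symtrop :: "symtrop \<Rightarrow> symtrop \<Rightarrow> symtrop" where
  "TZero * y = TZero"
| "x * TZero = TZero"
| "Elem s p * Elem t q = Elem (tsign_mult s t) (p + q)"

instance
proof
  fix x y z :: symtrop
  have tm_commute: "tsign_mult s t = tsign_mult t s" for s t
    by (cases s; cases t) auto
  have tm_assoc: "tsign_mult (tsign_mult s t) u = tsign_mult s (tsign_mult t u)" for s t u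
    by (cases s; cases t; cases u) auto
  have tm_unit: "tsign_mult SPos s = s" for s
    by (cases s) auto
  have tm_cancel: "tsign_mult s u = tsign_mult t u \<longleftrightarrow> tsign_mult s u = SBal \<and> tsign_mult t u = SBal"
    if "s \<noteq> t" for s t u
    using that by (cases s; cases t; cases u) auto
  show "x + y + z = x + (y + z)"
    by (cases x; cases y; cases z) auto
  show "x + y = y + x"
    by (cases x; cases y) auto
  show "0 + x = x"
    by (simp add: zero_symtrop_def)
  show "x * y * z = x * (y * z)"
    by (cases x; cases y; cases z) (auto simp: tm_assoc)
  show "x * y = y * x"
    by (cases x; cases y) (auto simp: tm_commute)
  show "1 * x = x"
    by (cases x) (auto simp: one_symtrop_def tm_unit)
  show "(x + y) * z = x * z + y * z"
    by (cases x; cases y; cases z) (auto simp: tm_cancel)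
  show "0 * x = 0" "x * 0 = 0"
    by (cases x; simp add: zero_symtrop_def)+
  show "(0::symtrop) \<noteq> 1"
    by (simp add: zero_symtrop_def one_symtrop_def)
qed

end

definition trop_pos :: "symtrop set" where
  "trop_pos = range (Elem SPos)"

definition trop_neg :: "symtrop set" where
  "trop_neg = range (Elem SNeg)"

definition trop_bal :: "symtrop set" where
  "trop_bal = insert 0 (range (Elem SBal))"

definition trop_signed :: "symtrop set" where
  "trop_signed = trop_pos \<union> trop_neg \<union> {0}"

definition signed_space :: "(symtrop ^ 'd) set" where
  "signed_space = {x. \<forall>i. x $ i \<in> trop_signed}"

definition trop_affine :: "symtrop \<Rightarrow> symtrop ^ 'd \<Rightarrow> symtrop ^ 'd \<Rightarrow> symtrop" where
  "trop_affine a0 a x = a0 + (\<Sum>i\<in>UNIV. a $ i * x $ i)"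

text \<open>
  A coefficient vector with entries indexed by \<open>0, \<dots>, d\<close> is given as its constant term \<open>a0\<close>
  together with its linear part \<open>a\<close>, where \<open>d = CARD('d)\<close>.
\<close>
definition halfspace_coeffs :: "symtrop \<Rightarrow> symtrop ^ 'd \<Rightarrow> bool" where
  "halfspace_coeffs a0 a \<longleftrightarrow> a0 \<in> trop_signed \<and> a \<in> signed_space \<and> a \<noteq> 0"

definition open_halfspace :: "symtrop \<Rightarrow> symtrop ^ 'd \<Rightarrow> (symtrop ^ 'd) set" where
  "open_halfspace a0 a = {x \<in> signed_space. trop_affine a0 a x \<in> trop_pos}"

definition closed_halfspace :: "symtrop \<Rightarrow> symtrop ^ 'd \<Rightarrow> (symtrop ^ 'd) set" where
  "closed_halfspace a0 a = {x \<in> signed_space. trop_affine a0 a x \<in> trop_pos \<union> trop_bal}"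

text \<open>
  The family intersected here is never empty for signed \<open>x\<close> and \<open>y\<close>: a positive constant term
  of large norm gives a closed halfspace containing both points.
\<close>
definition conv_TC :: "symtrop ^ 'd \<Rightarrow> symtrop ^ 'd \<Rightarrow> (symtrop ^ 'd) set" where
  "conv_TC x y = \<Inter> {closed_halfspace a0 a | a0 a.
     halfspace_coeffs a0 a \<and> x \<in> closed_halfspace a0 a \<and> y \<in> closed_halfspace a0 a}"

definition TC_convex :: "(symtrop ^ 'd) set \<Rightarrow> bool" where
  "TC_convex X \<longleftrightarrow> X \<subseteq> signed_space \<and> (\<forall>x\<in>X. \<forall>y\<in>X. conv_TC x y \<subseteq> X)"

definition TC_hemispace :: "(symtrop ^ 'd) set \<Rightarrow> bool" where
  "TC_hemispace X \<longleftrightarrow> TC_convex X \<and> TC_convex (signed_space - X)"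

end

theory Submission
  imports Defs
begin

text \<open>
  The separating coefficients are read off from a few test points. After exchanging \<open>G\<close> with its
  complement and flipping signs of coordinates, \<open>G\<close> contains the origin and all positive multiples
  of the unit vectors \<open>e\<^sub>i\<close>. If every negative half-axis meets \<open>G\<close>, then \<open>a\<^sub>0\<close> is the unit
  and \<open>a\<^sub>i\<close> is the inverse of the threshold beyond which the points \<open>\<ominus>re\<^sub>i\<close> leave \<open>G\<close>.
  Otherwise some negative half-axes lie entirely in the complement, so that \<open>a\<^sub>0\<close> has to be the
  tropical zero; the coefficients are then given by the thresholds of the points
  \<open>e\<^sub>m \<ominus> re\<^sub>j\<close>, where \<open>m\<close> is such a half-axis whose coefficient has maximal norm.
  If one term of \<open>a(x)\<close> strictly dominates all terms of the opposite sign, then \<open>x\<close> can be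
  compared with these test points by cancelling its coordinates one at a time, which decides on
  which side \<open>x\<close> lies.
\<close>

section \<open>Scalars\<close>

abbreviation Pos :: "real \<Rightarrow> symtrop" where "Pos \<equiv> Elem SPos"
abbreviation Neg :: "real \<Rightarrow> symtrop" where "Neg \<equiv> Elem SNeg"

lemma TZero_eq_0 [simp]: "TZero = 0"
  by (simp add: zero_symtrop_def)

lemma Elem_neq_0 [simp]: "Elem s r \<noteq> 0" "0 \<noteq> Elem s r"
  by (simp_all add: zero_symtrop_def del: TZero_eq_0)

lemma Pos_0_mult [simp]: "Pos 0 * x = x"
  using mult_1_left[of x] by (simp add: one_symtrop_def)

lemma symtrop_cases [case_names zero Pos Neg Bal, cases type: symtrop]:
  obtains "x = 0" | r where "x = Pos r" | r where "x = Neg r" | r where "x = Elem SBal r"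
  by (metis TZero_eq_0 symtrop.exhaust tsign.exhaust)

lemma tsign_mult_SPos [simp]: "tsign_mult SPos s = s" "tsign_mult s SPos = s"
  by (cases s; simp)+

lemma trop_signed_simps [simp]: "0 \<in> trop_signed" "Elem s r \<in> trop_signed \<longleftrightarrow> s \<noteq> SBal"
  by (cases s; auto simp: trop_signed_def trop_pos_def trop_neg_def)+

lemma trop_pos_simps [simp]: "0 \<notin> trop_pos" "Elem s r \<in> trop_pos \<longleftrightarrow> s = SPos"
  by (auto simp: trop_pos_def)

lemma trop_neg_simps [simp]: "0 \<notin> trop_neg" "Elem s r \<in> trop_neg \<longleftrightarrow> s = SNeg"
  by (auto simp: trop_neg_def)

lemma trop_bal_simps [simp]: "0 \<in> trop_bal" "Elem s r \<in> trop_bal \<longleftrightarrow> s = SBal"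
  by (auto simp: trop_bal_def)

lemma symtrop_add_idem [simp]: "x + x = (x :: symtrop)"
  by (cases x) auto

lemma trop_signed_mult: "x \<in> trop_signed \<Longrightarrow> y \<in> trop_signed \<Longrightarrow> x * y \<in> trop_signed"
  by (cases x; cases y) auto

text \<open>A balanced value stands for the whole interval of elements of norm at most
  \<open>r\<close>, while any other value stands only for itself. In particular
  \<open>fills 0 w\<close> with \<open>w\<close> balanced expresses that two opposite terms have
  cancelled.\<close>

definition fills :: "symtrop \<Rightarrow> symtrop \<Rightarrow> bool" where
  "fills z w \<longleftrightarrow> z = w \<or> (\<exists>r. w = Elem SBal r \<and> (\<forall>s q. z = Elem s q \<longrightarrow> q \<le> r))"

lemma fills_refl [simp]: "fills z z"
  by (simp add: fills_def)

lemma fills_Bal [simp]: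
  "fills 0 (Elem SBal r)" "s \<noteq> SBal \<Longrightarrow> fills (Elem s q) (Elem SBal r) \<longleftrightarrow> q \<le> r"
  by (auto simp: fills_def)

lemma fills_mult:
  assumes "fills z w" "a \<in> trop_signed"
  shows "fills (a * z) (a * w)"
  using assms by (cases a; cases z; cases w) (auto simp: fills_def)

text \<open>If \<open>w\<close> differs from \<open>u + v\<close>, then \<open>u\<close> and
  \<open>v\<close> are opposite of some norm \<open>r\<close>. The summand next to the negative one
  must be positive or balanced of norm at least \<open>r\<close>, and this outweighs or balances
  every \<open>w\<close> of norm at most \<open>r\<close>.\<close>

lemma fills_add_nonneg:
  assumes "u \<in> trop_signed" "v \<in> trop_signed" "fills w (u + v)"
    and "x + u \<in> trop_pos \<union> trop_bal" "y + v \<in> trop_pos \<union> trop_bal"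
  shows "x + y + w \<in> trop_pos \<union> trop_bal"
proof (cases "w = u + v")
  case True
  then have "x + y + w = (x + u) + (y + v)"
    by (simp add: ac_simps)
  moreover have "s + t \<in> trop_pos \<union> trop_bal"
    if "s \<in> trop_pos \<union> trop_bal" "t \<in> trop_pos \<union> trop_bal" for s t
    using that by (cases s; cases t) auto
  ultimately show ?thesis
    using assms by presburger
next
  case False
  then obtain r where r: "u + v = Elem SBal r" "\<And>s q. w = Elem s q \<Longrightarrow> q \<le> r"
    using assms(3) by (auto simp: fills_def)
  with assms(1,2) have "u = Pos r \<and> v = Neg r \<or> u = Neg r \<and> v = Pos r"
    by (cases u; cases v) (auto split: if_splits)
  then show ?thesis
    using r(2) assms(4,5) by (cases x; cases y; cases w) (auto split: if_splits)
qed

text \<open>Terms of maximal norm with different signs would make the sum balanced. The resulting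
  strict bound for a signed sum is the gap exploited in
  \<open>trop_affine_dominating\<close>.\<close>

lemma sum_symtrop_dominating:
  fixes t :: "'a \<Rightarrow> symtrop"
  assumes "finite F"
  shows "(sum t F = 0 \<longrightarrow> (\<forall>j\<in>F. t j = 0)) \<and>
    (\<forall>s r. sum t F = Elem s r \<longrightarrow>
      (\<forall>j\<in>F. \<forall>u q. t j = Elem u q \<longrightarrow> q \<le> r \<and> (s \<noteq> SBal \<longrightarrow> u \<noteq> s \<longrightarrow> q < r)) \<and>
      (s \<noteq> SBal \<longrightarrow> (\<exists>i\<in>F. t i = Elem s r)))"
  using assms
proof (induction F)
  case empty
  then show ?case by simp
next
  case (insert x F)
  show ?case
  proof (cases "sum t F" rule: symtrop.exhaust)
    case TZero
    then show ?thesis using insert by simp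
  next
    case S: (Elem s r)
    show ?thesis
    proof (cases "t x" rule: symtrop.exhaust)
      case TZero
      then show ?thesis using insert S by simp
    next
      case (Elem u q)
      then show ?thesis using insert S
        by (fastforce split: if_splits)
    qed
  qed
qed

section \<open>Two-point operations\<close>

text \<open>
  Allowing only one coordinate \<open>i\<close> in which opposite terms of equal norm cancel is essential:
  when two coordinates cancel, the corresponding points need not lie in \<open>conv_TC x y\<close>.
\<close>
definition tc_closed :: "(symtrop ^ 'd) set \<Rightarrow> bool" where
  "tc_closed X \<longleftrightarrow> (\<forall>x\<in>X. \<forall>y\<in>X. \<forall>p q z i. max p q = 0 \<longrightarrow> z \<in> signed_space \<longrightarrow>
     (\<forall>j. j \<noteq> i \<longrightarrow> z $ j = Pos p * x $ j + Pos q * y $ j) \<longrightarrow>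
     fills (z $ i) (Pos p * x $ i + Pos q * y $ i) \<longrightarrow> z \<in> X)"

text \<open>Every affine form splits into its part \<open>R\<close> away from coordinate
  \<open>i\<close>, which respects the combination exactly, and the term at \<open>i\<close>, where
  \<open>fills_add_nonneg\<close> absorbs the freedom in choosing \<open>z $ i\<close>.\<close>

lemma in_conv_TC:
  fixes x y z :: "symtrop ^ 'd"
  assumes x: "x \<in> signed_space" and y: "y \<in> signed_space" and z: "z \<in> signed_space"
    and pq: "max p q = (0::real)"
    and eq: "\<And>j. j \<noteq> i \<Longrightarrow> z $ j = Pos p * x $ j + Pos q * y $ j"
    and fi: "fills (z $ i) (Pos p * x $ i + Pos q * y $ i)"
  shows "z \<in> conv_TC x y"
proof -
  have "z \<in> closed_halfspace a0 a"
    if a: "halfspace_coeffs a0 a" and xa: "x \<in> closed_halfspace a0 a"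
      and ya: "y \<in> closed_halfspace a0 a" for a0 and a :: "symtrop ^ 'd"
  proof -
    define R where "R = (\<lambda>v::symtrop ^ 'd. a0 + (\<Sum>j\<in>UNIV - {i}. a $ j * v $ j))"
    have split: "trop_affine a0 a v = R v + a $ i * v $ i" for v
      unfolding trop_affine_def R_def
      by (subst sum.remove[of _ i]) (simp_all add: ac_simps)
    \<comment> \<open>The normalisation of \<open>p\<close> and \<open>q\<close> is what allows the
      constant term \<open>a0\<close> to be distributed over the two points.\<close>
    have one: "Pos p + Pos q = 1"
      using pq by (auto simp: one_symtrop_def max_def split: if_splits)
    have sum: "(\<Sum>j\<in>UNIV - {i}. a $ j * z $ j)
      = Pos p * (\<Sum>j\<in>UNIV - {i}. a $ j * x $ j) + Pos q * (\<Sum>j\<in>UNIV - {i}. a $ j * y $ j)"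
      by (simp add: eq sum_distrib_left sum.distrib[symmetric] algebra_simps)
    have "R z = (Pos p + Pos q) * a0
      + (Pos p * (\<Sum>j\<in>UNIV - {i}. a $ j * x $ j) + Pos q * (\<Sum>j\<in>UNIV - {i}. a $ j * y $ j))"
      unfolding R_def sum one by simp
    also have "\<dots> = Pos p * R x + Pos q * R y"
      unfolding R_def by (simp only: distrib_left distrib_right ac_simps)
    finally have Rz: "R z = Pos p * R x + Pos q * R y" .
    have ai: "a $ i \<in> trop_signed"
      using a by (auto simp: halfspace_coeffs_def signed_space_def)
    have scale: "Pos k * s \<in> trop_pos \<union> trop_bal" if "s \<in> trop_pos \<union> trop_bal" for k s
      using that by (cases s) auto
    have "Pos p * R x + Pos q * R y + a $ i * z $ i \<in> trop_pos \<union> trop_bal"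
    proof (rule fills_add_nonneg)
      show "Pos p * (a $ i * x $ i) \<in> trop_signed" "Pos q * (a $ i * y $ i) \<in> trop_signed"
        using x y ai by (auto simp: signed_space_def intro!: trop_signed_mult)
      show "fills (a $ i * z $ i) (Pos p * (a $ i * x $ i) + Pos q * (a $ i * y $ i))"
        using fills_mult[OF fi ai] by (simp add: algebra_simps)
      show "Pos p * R x + Pos p * (a $ i * x $ i) \<in> trop_pos \<union> trop_bal"
        using scale[of "trop_affine a0 a x" p] xa
        by (simp add: split closed_halfspace_def distrib_left)
      show "Pos q * R y + Pos q * (a $ i * y $ i) \<in> trop_pos \<union> trop_bal"
        using scale[of "trop_affine a0 a y" q] ya
        by (simp add: split closed_halfspace_def distrib_left)
    qed
    then show ?thesis
      using z by (simp add: closed_halfspace_def split Rz)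
  qed
  then show ?thesis
    by (auto simp: conv_TC_def)
qed

lemma TC_convex_imp_tc_closed: "TC_convex X \<Longrightarrow> tc_closed X"
  unfolding tc_closed_def TC_convex_def by (meson in_conv_TC subsetD)

lemma tc_closed_add:
  assumes "tc_closed X" "x \<in> X" "y \<in> X" "z \<in> signed_space"
    and "\<And>j. j \<noteq> i \<Longrightarrow> z $ j = x $ j + y $ j" "fills (z $ i) (x $ i + y $ i)"
  shows "z \<in> X"
proof -
  have "max (0::real) 0 = 0" by simp
  then show ?thesis
    using assms unfolding tc_closed_def by (metis Pos_0_mult)
qed

lemma tc_closed_scale_add:
  assumes "tc_closed X" "x \<in> X" "y \<in> X" "z \<in> signed_space" "p \<le> 0"
    and "\<And>j. j \<noteq> i \<Longrightarrow> z $ j = Pos p * x $ j + y $ j" "fills (z $ i) (Pos p * x $ i + y $ i)"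
  shows "z \<in> X"
proof -
  have "max p 0 = 0" using \<open>p \<le> 0\<close> by simp
  then show ?thesis
    using assms unfolding tc_closed_def by (metis Pos_0_mult)
qed

section \<open>Test points, and changing one coordinate at a time\<close>

definition trop_scale :: "real \<Rightarrow> symtrop ^ 'd \<Rightarrow> symtrop ^ 'd" where
  "trop_scale p x = (\<chi> j. Pos p * x $ j)"

definition restr :: "'d set \<Rightarrow> symtrop ^ 'd \<Rightarrow> symtrop ^ 'd" where
  "restr C x = (\<chi> j. if j \<in> C then x $ j else 0)"

text \<open>Both norms are parameters so that the family of two-coordinate test points is stable
  under scaling.\<close>

definition axis_pair :: "'d \<Rightarrow> 'd \<Rightarrow> real \<Rightarrow> real \<Rightarrow> symtrop ^ 'd" where
  "axis_pair i j p q = (\<chi> k. if k = i then Pos p else if k = j then Neg q else 0)"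

lemma trop_scale_nth [simp]: "trop_scale p x $ j = Pos p * x $ j"
  by (simp add: trop_scale_def)

lemma restr_nth [simp]: "restr C x $ j = (if j \<in> C then x $ j else 0)"
  by (simp add: restr_def)

lemma axis_pair_nth [simp]: "axis_pair i j p q $ k = (if k = i then Pos p else if k = j then Neg q else 0)"
  by (simp add: axis_pair_def)

lemma axis_nth_if [simp]: "axis i s $ j = (if j = i then s else 0)"
  by (simp add: axis_def)

lemma axis_zero [simp]: "axis i 0 = 0"
  by (simp add: vec_eq_iff)

lemma signed_spaceI: "(\<And>i. x $ i \<in> trop_signed) \<Longrightarrow> x \<in> signed_space"
  by (simp add: signed_space_def)

lemma signed_spaceD [simp]: "x \<in> signed_space \<Longrightarrow> x $ i \<in> trop_signed"
  by (simp add: signed_space_def)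

lemma signed_space_simps [simp]:
  "0 \<in> signed_space"
  "axis i s \<in> signed_space \<longleftrightarrow> s \<in> trop_signed"
  "axis_pair i j p q \<in> signed_space"
  "x \<in> signed_space \<Longrightarrow> trop_scale p x \<in> signed_space"
  "x \<in> signed_space \<Longrightarrow> restr C x \<in> signed_space"
  using signed_spaceD[of "axis i s" i] by (auto intro!: signed_spaceI trop_signed_mult)

lemma trop_scale_scale: "trop_scale p (trop_scale q x) = trop_scale (p + q) x"
  by (simp add: vec_eq_iff mult.assoc[symmetric])

lemma trop_scale_0 [simp]: "trop_scale 0 x = x"
  by (simp add: vec_eq_iff)

lemma trop_scale_axis: "trop_scale p (axis i s) = axis i (Pos p * s)"
  by (simp add: vec_eq_iff)

lemma trop_scale_pair: "trop_scale p (axis_pair i j q r) = axis_pair i j (p + q) (p + r)"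
  by (simp add: vec_eq_iff)

lemma restr_UNIV [simp]: "restr UNIV x = x"
  by (simp add: vec_eq_iff)

lemma restr_empty [simp]: "restr {} x = 0"
  by (simp add: vec_eq_iff)

lemma restr_singleton [simp]: "restr {i} x = axis i (x $ i)"
  by (simp add: vec_eq_iff)

text \<open>Addition is idempotent, so the shared entries on \<open>C\<close> survive while the
  pieces contribute their extra coordinates one by one; nothing cancels.\<close>

lemma tc_closed_assemble:
  fixes x :: "symtrop ^ 'd"
  assumes X: "tc_closed X" and x: "x \<in> signed_space" and base: "restr C x \<in> X"
    and pieces: "\<And>j. j \<notin> C \<Longrightarrow> restr (insert j C) x \<in> X"
  shows "x \<in> X"
proof -
  have "restr (C \<union> F) x \<in> X" if "finite F" for F
    using that
  proof induction
    case empty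
    then show ?case using base by simp
  next
    case (insert j F)
    have "restr (insert j C) x \<in> X"
      using pieces base by (cases "j \<in> C") (auto simp: insert_absorb)
    from X insert.IH this show ?case
      by (rule tc_closed_add[where i = j]) (use x in auto)
  qed
  from this[of UNIV] show ?thesis by simp
qed

text \<open>The witness \<open>w\<close> is absorbed on \<open>C\<close> and vanishes at the other
  coordinates outside \<open>C\<close>, so each step cancels only coordinate \<open>j\<close>, as
  \<open>tc_closed\<close> demands.\<close>

lemma tc_closed_eliminate:
  fixes x :: "symtrop ^ 'd"
  assumes X: "tc_closed X" and x: "x \<in> signed_space" "x \<in> X"
    and elim: "\<And>j. j \<notin> C \<Longrightarrow> \<exists>w\<in>X. (\<forall>k\<in>C. x $ k + w $ k = x $ k) \<and>
      (\<forall>k. k \<notin> C \<longrightarrow> k \<noteq> j \<longrightarrow> w $ k = 0) \<and> fills 0 (x $ j + w $ j)"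
  shows "restr C x \<in> X"
proof -
  have "F \<inter> C = {} \<longrightarrow> restr (- F) x \<in> X" if "finite F" for F
    using that
  proof induction
    case empty
    then show ?case using x by simp
  next
    case (insert j F)
    show ?case
    proof
      assume disj: "insert j F \<inter> C = {}"
      then have "j \<notin> C" by blast
      from elim[OF this] obtain w where w: "w \<in> X" "\<forall>k\<in>C. x $ k + w $ k = x $ k"
        "\<forall>k. k \<notin> C \<longrightarrow> k \<noteq> j \<longrightarrow> w $ k = 0" "fills 0 (x $ j + w $ j)"
        by (elim bexE conjE)
      have "restr (- F) x \<in> X" using insert disj by blast
      then show "restr (- insert j F) x \<in> X"
      proof (rule tc_closed_add[OF X _ w(1), where i = j])
        show "restr (- insert j F) x \<in> signed_space" using x by simp
        show "restr (- insert j F) x $ k = restr (- F) x $ k + w $ k" if "k \<noteq> j" for k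
          using that w(2,3) disj by (cases "k \<in> C") auto
        show "fills (restr (- insert j F) x $ j) (restr (- F) x $ j + w $ j)"
          using w(4) insert by simp
      qed
    qed
  qed
  from this[of "- C"] show ?thesis by auto
qed

text \<open>There are finitely many terms, so a level \<rho> fits strictly between the dominating
  term and all terms of other signs. It serves later as a scaling factor or as the norm of an
  auxiliary coordinate.\<close>

lemma trop_affine_dominating:
  fixes x :: "symtrop ^ 'd"
  assumes eq: "trop_affine a0 a x = Elem s r" and s: "s \<noteq> SBal"
  obtains \<rho> where "\<rho> < r"
    "\<And>j u q. u \<noteq> s \<Longrightarrow> a $ j * x $ j = Elem u q \<Longrightarrow> q < \<rho>"
    "\<And>u q. u \<noteq> s \<Longrightarrow> a0 = Elem u q \<Longrightarrow> q < \<rho>"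
    "a0 = Elem s r \<or> (\<exists>i. a $ i * x $ i = Elem s r)"
proof -
  \<comment> \<open>Indexing by \<open>'d option\<close> lets the constant term take part as the
    term at \<open>None\<close>.\<close>
  define t where "t = (\<lambda>k. case k of None \<Rightarrow> a0 | Some j \<Rightarrow> a $ j * x $ j)"
  have "sum t UNIV = trop_affine a0 a x"
    by (simp add: UNIV_option_conv sum.reindex t_def trop_affine_def)
  then have "sum t UNIV = Elem s r"
    using eq by simp
  with sum_symtrop_dominating[of "UNIV :: 'd option set" t] s
  have dom: "\<forall>k u q. t k = Elem u q \<longrightarrow> q \<le> r \<and> (s \<noteq> SBal \<longrightarrow> u \<noteq> s \<longrightarrow> q < r)" "\<exists>k. t k = Elem s r"
    by simp_all
  have t: "q < r" if "t k = Elem u q" "u \<noteq> s" for k u q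
    using dom(1) that s by blast
  \<comment> \<open>The element \<open>r - 1\<close> keeps \<open>Q\<close> nonempty when no term
    has another sign, so that \<open>Max Q\<close> is meaningful.\<close>
  define Q where "Q = insert (r - 1) {q. \<exists>k u. t k = Elem u q \<and> u \<noteq> s}"
  have "q \<in> range (\<lambda>k. case t k of TZero \<Rightarrow> 0 | Elem u q \<Rightarrow> q)" if "t k = Elem u q" for k u q
    using that by (intro range_eqI[of _ _ k]) simp
  then have "Q \<subseteq> insert (r - 1) (range (\<lambda>k. case t k of TZero \<Rightarrow> 0 | Elem u q \<Rightarrow> q))"
    unfolding Q_def by blast
  then have fin: "finite Q"
    by (rule finite_subset) simp
  have "Q \<noteq> {}" "\<forall>q\<in>Q. q < r"
    using t unfolding Q_def by auto
  then have "Max Q < r"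
    using fin by simp
  then obtain \<rho> where \<rho>: "Max Q < \<rho>" "\<rho> < r"
    using dense by blast
  have less: "q < \<rho>" if "t k = Elem u q" "u \<noteq> s" for k u q
  proof -
    have "q \<in> Q"
      using that unfolding Q_def by blast
    with Max_ge[OF fin this] \<rho>(1) show ?thesis by linarith
  qed
  show ?thesis
  proof
    show "\<rho> < r" by fact
    show "q < \<rho>" if "u \<noteq> s" "a $ j * x $ j = Elem u q" for j u q
      using less[of "Some j" u q] that by (simp add: t_def)
    show "q < \<rho>" if "u \<noteq> s" "a0 = Elem u q" for u q
      using less[of None u q] that by (simp add: t_def)
    show "a0 = Elem s r \<or> (\<exists>i. a $ i * x $ i = Elem s r)"
      using dom(2) by (auto simp: t_def split: option.splits)
  qed
qed

section \<open>Separation when the nonnegative orthant is contained in the hemispace\<close>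

text \<open>The witness is the tropical inverse of \<open>Inf B\<close>, with \<open>0\<close> for
  an infinite threshold. Whether the infimum belongs to \<open>B\<close> stays open, hence one weak
  and one strict inequality.\<close>

lemma threshold:
  fixes B :: "real set"
  assumes up: "\<And>r r'. r \<in> B \<Longrightarrow> r \<le> r' \<Longrightarrow> r' \<in> B" and r0: "r0 \<notin> B"
  shows "\<exists>c. (c = 0 \<or> (\<exists>\<alpha>. c = Pos \<alpha>)) \<and> (\<forall>r\<in>B. \<exists>\<alpha>. c = Pos \<alpha> \<and> 0 \<le> \<alpha> + r) \<and>
    (\<forall>\<alpha> r. c = Pos \<alpha> \<longrightarrow> 0 < \<alpha> + r \<longrightarrow> r \<in> B)"
proof (cases "B = {}")
  case True
  then show ?thesis by (intro exI[of _ 0]) simp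
next
  case False
  have bdd: "bdd_below B"
    using up r0 by (intro bdd_belowI[of _ r0]) (meson linear)
  have "r \<in> B" if "Inf B < r" for r
    using cInf_lessD[OF False that] up by (meson less_imp_le)
  then show ?thesis
    using cInf_lower[OF _ bdd] by (intro exI[of _ "Pos (- Inf B)"]) auto
qed

text \<open>Closure under the two-point operations is assumed instead of TC-convexity, since it
  passes directly to preimages under sign changes.\<close>

locale orthant_hemispace =
  fixes G :: "(symtrop ^ 'd) set"
  assumes G_signed: "G \<subseteq> signed_space"
    and G_closed: "tc_closed G"
    and compl_closed: "tc_closed (signed_space - G)"
    and zero_in: "0 \<in> G"
    and axis_Pos_in: "axis i (Pos r) \<in> G"
begin

lemma scale_in:
  assumes "x \<in> G" "p \<le> 0"
  shows "trop_scale p x \<in> G"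
  using assms G_signed by (intro tc_closed_scale_add[OF G_closed assms(1) zero_in _ assms(2)]) auto

section \<open>All negative half-axes meet \<open>G\<close>\<close>

lemma axis_Neg_notin_mono:
  assumes "axis i (Neg r) \<notin> G" "r \<le> r'"
  shows "axis i (Neg r') \<notin> G"
  using scale_in[of "axis i (Neg r')" "r - r'"] assms by (auto simp: trop_scale_axis)

lemma separating_bounded_axes:
  assumes bounded: "\<And>i. \<exists>r. axis i (Neg r) \<in> G"
  shows "\<exists>a\<in>signed_space. \<forall>x\<in>signed_space.
    (trop_affine 1 a x \<in> trop_pos \<longrightarrow> x \<in> G) \<and> (trop_affine 1 a x \<in> trop_neg \<longrightarrow> x \<notin> G)"
proof -
  have "\<exists>c. (c = 0 \<or> (\<exists>\<alpha>. c = Pos \<alpha>)) \<and>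
    (\<forall>r\<in>{r. axis i (Neg r) \<notin> G}. \<exists>\<alpha>. c = Pos \<alpha> \<and> 0 \<le> \<alpha> + r) \<and>
    (\<forall>\<alpha> r. c = Pos \<alpha> \<longrightarrow> 0 < \<alpha> + r \<longrightarrow> r \<in> {r. axis i (Neg r) \<notin> G})" for i
  proof -
    obtain r where "axis i (Neg r) \<in> G" using bounded by blast
    then show ?thesis
      by (intro threshold[of _ r]) (auto dest: axis_Neg_notin_mono)
  qed
  then obtain c where c:
    "\<And>i. c i = 0 \<or> (\<exists>\<alpha>. c i = Pos \<alpha>)"
    "\<And>i r. axis i (Neg r) \<notin> G \<Longrightarrow> \<exists>\<alpha>. c i = Pos \<alpha> \<and> 0 \<le> \<alpha> + r"
    "\<And>i \<alpha> r. c i = Pos \<alpha> \<Longrightarrow> 0 < \<alpha> + r \<Longrightarrow> axis i (Neg r) \<notin> G"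
    by (simp add: choice_iff') metis
  define a where "a = (\<chi> i. c i)"
  have a_nth: "a $ i = c i" for i by (simp add: a_def)
  have signed: "a \<in> signed_space"
  proof (rule signed_spaceI)
    show "a $ i \<in> trop_signed" for i
      using c(1)[of i] by (auto simp: a_nth)
  qed
  \<comment> \<open>If all negative terms lie below the unit constant term, every axis component of
    \<open>x\<close> is within its threshold, and \<open>x\<close> is assembled from these
    components.\<close>
  have dominated: "x \<in> G" if x: "x \<in> signed_space"
    and small: "\<And>j \<alpha> q. c j = Pos \<alpha> \<Longrightarrow> x $ j = Neg q \<Longrightarrow> \<alpha> + q < 0" for x
  proof (rule tc_closed_assemble[OF G_closed x, of "{}"])
    show "restr {} x \<in> G" using zero_in by simp
    show "restr {j} x \<in> G" for j
    proof (cases "x $ j")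
      case zero
      then show ?thesis using zero_in by simp
    next
      case (Pos r)
      then show ?thesis using axis_Pos_in by simp
    next
      case (Neg q)
      then show ?thesis using c(2)[of j q] small[of j _ q] by force
    next
      case (Bal r)
      then show ?thesis using signed_spaceD[OF x, of j] by simp
    qed
  qed
  have pos: "x \<in> G" if x: "x \<in> signed_space" and r: "trop_affine 1 a x = Pos r" for x r
  proof -
    from trop_affine_dominating[OF r] obtain \<rho> where \<rho>: "\<rho> < r"
      "\<And>j u q. u \<noteq> SPos \<Longrightarrow> a $ j * x $ j = Elem u q \<Longrightarrow> q < \<rho>"
      "(1::symtrop) = Pos r \<or> (\<exists>i. a $ i * x $ i = Pos r)"
      by (metis tsign.distinct(3))
    have neg: "\<alpha> + q < \<rho>" if "c j = Pos \<alpha>" "x $ j = Neg q" for j \<alpha> q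
      using \<rho>(2)[of SNeg j "\<alpha> + q"] that by (simp add: a_nth)
    show ?thesis
    proof (cases "r \<le> 0")
      case True
      then show ?thesis
        using neg \<rho>(1) by (intro dominated[OF x]) force
    next
      case False
      with \<rho>(3) obtain i where i: "a $ i * x $ i = Pos r"
        by (auto simp: one_symtrop_def)
      obtain \<alpha> p where \<alpha>p: "c i = Pos \<alpha>" "x $ i = Pos p" "r = \<alpha> + p"
        using i c(1)[of i] by (cases "x $ i") (auto simp: a_nth)
      \<comment> \<open>Scaling by \<open>- \<sigma>\<close> brings all negative terms below the
        constant term, yet leaves coordinate \<open>i\<close> beyond its threshold. If
        \<open>x\<close> were outside \<open>G\<close>, cancelling that coordinate against a
        negative axis point outside \<open>G\<close> would put \<open>z\<close> outside too.\<close>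
      obtain \<sigma> where \<sigma>: "max \<rho> 0 < \<sigma>" "\<sigma> < r"
        using False \<rho>(1) dense[of "max \<rho> 0" r] by auto
      define z where "z = restr (- {i}) (trop_scale (- \<sigma>) x)"
      have z: "z \<in> signed_space" using x by (simp add: z_def)
      have "z \<in> G"
      proof (rule dominated[OF z])
        fix j \<beta> q assume "c j = Pos \<beta>" "z $ j = Neg q"
        then show "\<beta> + q < 0"
          using neg[of j \<beta> "q + \<sigma>"] \<sigma>(1) by (cases "x $ j") (auto simp: z_def split: if_splits)
      qed
      moreover have "z \<in> signed_space - G" if "x \<notin> G"
      proof (rule tc_closed_scale_add[OF compl_closed _ _ z, of x "axis i (Neg (p - \<sigma>))" "- \<sigma>" i])
        show "axis i (Neg (p - \<sigma>)) \<in> signed_space - G"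
          using c(3)[OF \<alpha>p(1), of "p - \<sigma>"] \<sigma>(2) \<alpha>p(3) by simp
      qed (use that x \<sigma> \<alpha>p in \<open>auto simp: z_def\<close>)
      ultimately show ?thesis by blast
    qed
  qed
  have neg: "x \<notin> G" if x: "x \<in> signed_space" and r: "trop_affine 1 a x = Neg r" for x r
  proof
    assume "x \<in> G"
    from trop_affine_dominating[OF r] obtain \<rho> where \<rho>: "\<rho> < r"
      "\<And>j u q. u \<noteq> SNeg \<Longrightarrow> a $ j * x $ j = Elem u q \<Longrightarrow> q < \<rho>"
      "\<And>u q. u \<noteq> SNeg \<Longrightarrow> (1::symtrop) = Elem u q \<Longrightarrow> q < \<rho>"
      "(1::symtrop) = Neg r \<or> (\<exists>i. a $ i * x $ i = Neg r)"
      by (metis tsign.distinct(5))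
    \<comment> \<open>The constant term is itself a term of the other sign; hence scaling by
      \<open>- \<rho>\<close> stays inside \<open>G\<close>.\<close>
    have "0 < \<rho>"
      using \<rho>(3)[of SPos 0] by (simp add: one_symtrop_def)
    from \<rho>(4) obtain i where i: "a $ i * x $ i = Neg r"
      by (auto simp: one_symtrop_def)
    obtain \<alpha> p where \<alpha>p: "c i = Pos \<alpha>" "x $ i = Neg p" "r = \<alpha> + p"
      using i c(1)[of i] by (cases "x $ i") (auto simp: a_nth)
    define y where "y = trop_scale (- \<rho>) x"
    have y: "y \<in> signed_space" "y \<in> G"
      using x scale_in[OF \<open>x \<in> G\<close>, of "- \<rho>"] \<open>0 < \<rho>\<close> by (simp_all add: y_def)
    \<comment> \<open>After scaling, the positive terms lie below 0, so the negatives of these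
      coordinates are axis points of \<open>G\<close> and can cancel them. What remains is a
      negative axis point beyond its threshold.\<close>
    have "restr {i} y \<in> G"
    proof (rule tc_closed_eliminate[OF G_closed y])
      fix j assume "j \<notin> {i}"
      obtain s where s: "axis j s \<in> G" "fills 0 (y $ j + s)"
      proof (cases "x $ j")
        case zero
        then show ?thesis using that[of 0] zero_in by (simp add: y_def)
      next
        case (Pos q)
        have "axis j (Neg (q - \<rho>)) \<in> G"
          using c(2)[of j "q - \<rho>"] \<rho>(2)[of SPos j] Pos by (force simp: a_nth)
        then show ?thesis using that[of "Neg (q - \<rho>)"] Pos by (simp add: y_def)
      next
        case (Neg q)
        then show ?thesis using that[of "Pos (q - \<rho>)"] axis_Pos_in by (simp add: y_def)
      next
        case (Bal q)
        then show ?thesis using signed_spaceD[OF x, of j] by simp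
      qed
      then show "\<exists>w\<in>G. (\<forall>k\<in>{i}. y $ k + w $ k = y $ k) \<and>
        (\<forall>k. k \<notin> {i} \<longrightarrow> k \<noteq> j \<longrightarrow> w $ k = 0) \<and> fills 0 (y $ j + w $ j)"
        using \<open>j \<notin> {i}\<close> by (intro bexI[of _ "axis j s"]) auto
    qed
    then show False
      using c(3)[OF \<alpha>p(1), of "p - \<rho>"] \<rho>(1) \<alpha>p by (simp add: y_def)
  qed
  show ?thesis
    using signed pos neg by (intro bexI[of _ a]) (auto simp: trop_pos_def trop_neg_def)
qed

section \<open>A negative half-axis avoids \<open>G\<close>\<close>

text \<open>This is why the constant term can be dropped when some negative half-axis avoids \<open>G\<close>.\<close>
lemma scale_iff:
  assumes x: "x \<in> signed_space" and i: "x $ i = Pos p" and free: "\<And>r. axis i (Neg r) \<notin> G"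
  shows "trop_scale k x \<in> G \<longleftrightarrow> x \<in> G"
proof -
  have down: "trop_scale k x \<in> G \<longleftrightarrow> x \<in> G"
    if "k \<le> 0" "x \<in> signed_space" "x $ i = Pos p" for k p and x :: "symtrop ^ 'd"
  proof
    assume "trop_scale k x \<in> G"
    moreover have "trop_scale k x \<in> signed_space - G" if "x \<notin> G"
      by (rule tc_closed_scale_add[OF compl_closed, of x "axis i (Neg (p + k))" _ k i])
        (use that free \<open>k \<le> 0\<close> \<open>x \<in> signed_space\<close> \<open>x $ i = Pos p\<close> in auto)
    ultimately show "x \<in> G" by blast
  qed (use scale_in that in blast)
  show ?thesis
  proof (cases "k \<le> 0")
    case True
    then show ?thesis using down x i by blast
  next
    case False
    then show ?thesis
      using down[of "- k" "trop_scale k x" "k + p"] x i by (simp add: trop_scale_scale)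
  qed
qed

lemma axis_pair_iff:
  assumes "\<And>r. axis i (Neg r) \<notin> G"
  shows "axis_pair i j p q \<in> G \<longleftrightarrow> axis_pair i j 0 (q - p) \<in> G"
  using scale_iff[of "axis_pair i j p q" i p "- p"] assms by (simp add: trop_scale_pair)

text \<open>Adding a positive axis point of norm \<open>q'\<close> balances the entry at
  \<open>j\<close>, and the balanced value can be filled by any smaller negative entry.\<close>

lemma axis_pair_notin_mono:
  assumes "i \<noteq> j" "axis_pair i j p q \<notin> G" "q \<le> q'"
  shows "axis_pair i j p q' \<notin> G"
proof
  assume "axis_pair i j p q' \<in> G"
  then have "axis_pair i j p q \<in> G"
    by (rule tc_closed_add[OF G_closed _ axis_Pos_in[of j q'], where i = j])
      (use assms in auto)
  then show False using assms(2) by blast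
qed

text \<open>Coefficients are measured relative to the unit at \<open>m\<close>; \<open>top\<close>
  ensures that none of them is infinite. A dominating coordinate other than \<open>m\<close> is
  traded for coordinate \<open>m\<close> at level \<rho>, which reduces everything to
  \<open>pos_m\<close> and \<open>neg_m\<close>.\<close>

lemma separating_free_axis:
  assumes free: "\<And>r. axis m (Neg r) \<notin> G" and top: "\<And>j. j \<noteq> m \<Longrightarrow> \<exists>q. axis_pair m j 0 q \<in> G"
  shows "\<exists>a\<in>signed_space. a \<noteq> 0 \<and> (\<forall>x\<in>signed_space.
    (trop_affine 0 a x \<in> trop_pos \<longrightarrow> x \<in> G) \<and> (trop_affine 0 a x \<in> trop_neg \<longrightarrow> x \<notin> G))"
proof -
  \<comment> \<open>The guard leaves \<open>c m\<close> arbitrary; \<open>a\<close> has the unit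
    there.\<close>
  have "\<exists>c. j \<noteq> m \<longrightarrow> ((c = 0 \<or> (\<exists>\<alpha>. c = Pos \<alpha>)) \<and>
    (\<forall>r\<in>{r. axis_pair m j 0 r \<notin> G}. \<exists>\<alpha>. c = Pos \<alpha> \<and> 0 \<le> \<alpha> + r) \<and>
    (\<forall>\<alpha> r. c = Pos \<alpha> \<longrightarrow> 0 < \<alpha> + r \<longrightarrow> r \<in> {r. axis_pair m j 0 r \<notin> G}))" for j
  proof (cases "j = m")
    case False
    then obtain r where "axis_pair m j 0 r \<in> G" using top by blast
    then have "\<exists>c. (c = 0 \<or> (\<exists>\<alpha>. c = Pos \<alpha>)) \<and>
      (\<forall>r\<in>{r. axis_pair m j 0 r \<notin> G}. \<exists>\<alpha>. c = Pos \<alpha> \<and> 0 \<le> \<alpha> + r) \<and>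
      (\<forall>\<alpha> r. c = Pos \<alpha> \<longrightarrow> 0 < \<alpha> + r \<longrightarrow> r \<in> {r. axis_pair m j 0 r \<notin> G})"
      using False by (intro threshold[of _ r]) (auto dest: axis_pair_notin_mono[rotated])
    then show ?thesis using False by simp
  qed simp
  then obtain c where c:
    "\<And>j. j \<noteq> m \<Longrightarrow> c j = 0 \<or> (\<exists>\<alpha>. c j = Pos \<alpha>)"
    "\<And>j r. j \<noteq> m \<Longrightarrow> axis_pair m j 0 r \<notin> G \<Longrightarrow> \<exists>\<alpha>. c j = Pos \<alpha> \<and> 0 \<le> \<alpha> + r"
    "\<And>j \<alpha> r. j \<noteq> m \<Longrightarrow> c j = Pos \<alpha> \<Longrightarrow> 0 < \<alpha> + r \<Longrightarrow> axis_pair m j 0 r \<notin> G"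
    by (simp add: choice_iff') metis
  define a where "a = (\<chi> j. if j = m then Pos 0 else c j)"
  have a_nth: "a $ j = (if j = m then Pos 0 else c j)" for j by (simp add: a_def)
  have a_cases: "a $ j = 0 \<or> (\<exists>\<alpha>. a $ j = Pos \<alpha>)" for j
    using c(1)[of j] by (auto simp: a_nth)
  have signed: "a \<in> signed_space"
  proof (rule signed_spaceI)
    show "a $ j \<in> trop_signed" for j
      using a_cases[of j] by auto
  qed
  have "a $ m \<noteq> 0" by (simp add: a_nth)
  then have "a \<noteq> 0" by (metis zero_index)
  have below: "\<exists>\<alpha>. a $ j = Pos \<alpha> \<and> p \<le> \<alpha> + q" if "j \<noteq> m" "axis_pair m j p q \<notin> G" for j p q
    using c(2)[of j "q - p"] axis_pair_iff[OF free, of j p q] that by (auto simp: a_nth algebra_simps)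
  have above: "axis_pair m j p q \<notin> G" if "j \<noteq> m" "a $ j = Pos \<alpha>" "p < \<alpha> + q" for j \<alpha> p q
    using c(3)[of j \<alpha> "q - p"] axis_pair_iff[OF free, of j p q] that by (simp add: a_nth algebra_simps)
  have swapped: "axis_pair i m p q \<in> G" if i: "i \<noteq> m" "a $ i = Pos \<alpha>" "q < \<alpha> + p" for i \<alpha> p q
  proof (rule ccontr)
    assume notin: "axis_pair i m p q \<notin> G"
    \<comment> \<open>The upper bound puts \<open>axis_pair m i s p\<close> outside
      \<open>G\<close>; the lower bound keeps coordinate \<open>m\<close> positive when the entries
      at \<open>i\<close> cancel.\<close>
    obtain s where s: "q < s" "s < \<alpha> + p" using i(3) dense by blast
    have "axis m (Pos s) \<in> signed_space - G"
      by (rule tc_closed_add[OF compl_closed, of "axis_pair i m p q" "axis_pair m i s p" _ i])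
        (use notin above[OF i(1,2) s(2)] i(1) s in auto)
    then show False using axis_Pos_in by blast
  qed
  have pos_m: "x \<in> G" if x: "x \<in> signed_space" and m: "x $ m = Pos p"
    and small: "\<And>j \<alpha> q. a $ j = Pos \<alpha> \<Longrightarrow> x $ j = Neg q \<Longrightarrow> \<alpha> + q < p" for x p
  proof (rule tc_closed_assemble[OF G_closed x, of "{m}"])
    show "restr {m} x \<in> G" using m axis_Pos_in by simp
    show "restr (insert j {m}) x \<in> G" if "j \<notin> {m}" for j
    proof (cases "x $ j")
      case zero
      then have "restr {j, m} x = axis m (Pos p)" using m by (simp add: vec_eq_iff)
      then show ?thesis using axis_Pos_in by simp
    next
      case (Pos q)
      then show ?thesis
        using x m that
        by (intro tc_closed_add[OF G_closed axis_Pos_in[of m p] axis_Pos_in[of j q], of _ j]) auto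
    next
      case (Neg q)
      then have "restr {j, m} x = axis_pair m j p q" using m by (simp add: vec_eq_iff)
      then show ?thesis using below[of j p q] small[of j _ q] Neg that by force
    next
      case (Bal r)
      then show ?thesis using signed_spaceD[OF x, of j] by simp
    qed
  qed
  have neg_m: "x \<notin> G" if x: "x \<in> signed_space" and m: "x $ m = Neg p"
    and small: "\<And>j \<alpha> q. a $ j = Pos \<alpha> \<Longrightarrow> x $ j = Pos q \<Longrightarrow> \<alpha> + q < p" for x p
  proof
    assume "x \<in> G"
    with x have "restr {m} x \<in> G"
    proof (rule tc_closed_eliminate[OF G_closed])
      fix j assume j: "j \<notin> {m}"
      show "\<exists>w\<in>G. (\<forall>k\<in>{m}. x $ k + w $ k = x $ k) \<and>
        (\<forall>k. k \<notin> {m} \<longrightarrow> k \<noteq> j \<longrightarrow> w $ k = 0) \<and> fills 0 (x $ j + w $ j)"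
      proof (cases "x $ j")
        case zero
        then show ?thesis using zero_in by (intro bexI[of _ 0]) auto
      next
        case (Pos q)
        \<comment> \<open>Being below \<open>p\<close>, the entry \<open>Pos s\<close> is absorbed
          at \<open>m\<close>; being above the term of \<open>j\<close>, it puts
          \<open>axis_pair m j s q\<close> into \<open>G\<close>.\<close>
        obtain s where s: "s < p" "\<And>\<alpha>. a $ j = Pos \<alpha> \<Longrightarrow> \<alpha> + q < s"
        proof (cases "\<exists>\<alpha>. a $ j = Pos \<alpha>")
          case True
          then obtain \<alpha> where \<alpha>: "a $ j = Pos \<alpha>" by blast
          obtain s where "\<alpha> + q < s" "s < p" using dense[OF small[OF \<alpha> Pos]] by blast
          then show ?thesis using that[of s] \<alpha> by auto
        next
          case False
          then show ?thesis using that[of "p - 1"] by auto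
        qed
        have "axis_pair m j s q \<in> G"
          using below[of j s q] s(2) j by force
        then show ?thesis
          using Pos m s(1) j by (intro bexI[of _ "axis_pair m j s q"]) auto
      next
        case (Neg q)
        then show ?thesis
          using axis_Pos_in[of j q] j by (intro bexI[of _ "axis j (Pos q)"]) auto
      next
        case (Bal q)
        then show ?thesis using signed_spaceD[OF x, of j] by simp
      qed
    qed
    then show False using m free by simp
  qed
  have pos: "x \<in> G" if x: "x \<in> signed_space" and r: "trop_affine 0 a x = Pos r" for x r
  proof -
    from trop_affine_dominating[OF r] obtain \<rho> i where \<rho>: "\<rho> < r"
      "\<And>j u q. u \<noteq> SPos \<Longrightarrow> a $ j * x $ j = Elem u q \<Longrightarrow> q < \<rho>"
      and i: "a $ i * x $ i = Pos r"
      by (metis Elem_neq_0(2) tsign.distinct(3))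
    obtain \<alpha> p where \<alpha>p: "a $ i = Pos \<alpha>" "x $ i = Pos p" "r = \<alpha> + p"
      using i a_cases[of i] by (cases "x $ i") auto
    have neg: "\<beta> + q < \<rho>" if "a $ j = Pos \<beta>" "x $ j = Neg q" for j \<beta> q
      using \<rho>(2)[of SNeg j "\<beta> + q"] that by simp
    show ?thesis
    proof (cases "i = m")
      case True
      then show ?thesis
        using \<alpha>p neg \<rho>(1) by (intro pos_m[OF x, of p]) (force simp: a_nth)+
    next
      case False
      \<comment> \<open>A negative entry at \<open>m\<close> has norm below \<rho>, since the
        coefficient there is the unit, so adding \<open>Pos \<rho>\<close> overrides it.\<close>
      have "\<exists>s. x $ m + Pos \<rho> = Pos s \<and> \<rho> \<le> s"
        using neg[of m 0] signed_spaceD[OF x, of m]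
        by (cases "x $ m") (auto simp: a_nth not_less dest: less_imp_le)
      then obtain s where s: "x $ m + Pos \<rho> = Pos s" "\<rho> \<le> s"
        by blast
      define z where "z = (\<chi> k. if k = i then 0 else if k = m then Pos s else x $ k)"
      have z: "z \<in> signed_space"
        using x by (auto simp: z_def intro: signed_spaceI)
      have "z \<in> G"
      proof (rule pos_m[OF z])
        show "z $ m = Pos s" using False by (simp add: z_def)
        show "\<beta> + q < s" if "a $ j = Pos \<beta>" "z $ j = Neg q" for j \<beta> q
          using neg[of j \<beta> q] that s(2) by (simp add: z_def split: if_splits)
      qed
      \<comment> \<open>As \<rho> is below the dominating term,
        \<open>axis_pair m i \<rho> p\<close> lies outside \<open>G\<close>; adding it to
        \<open>x\<close> cancels coordinate \<open>i\<close>.\<close>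
      moreover have "z \<in> signed_space - G" if "x \<notin> G"
        by (rule tc_closed_add[OF compl_closed, of x "axis_pair m i \<rho> p" _ i])
          (use that x z False above[OF False \<alpha>p(1), of \<rho> p] \<rho>(1) \<alpha>p s in \<open>auto simp: z_def\<close>)
      ultimately show ?thesis by blast
    qed
  qed
  have neg: "x \<notin> G" if x: "x \<in> signed_space" and r: "trop_affine 0 a x = Neg r" for x r
  proof -
    from trop_affine_dominating[OF r] obtain \<rho> i where \<rho>: "\<rho> < r"
      "\<And>j u q. u \<noteq> SNeg \<Longrightarrow> a $ j * x $ j = Elem u q \<Longrightarrow> q < \<rho>"
      and i: "a $ i * x $ i = Neg r"
      by (metis Elem_neq_0(2) tsign.distinct(5))
    obtain \<alpha> p where \<alpha>p: "a $ i = Pos \<alpha>" "x $ i = Neg p" "r = \<alpha> + p"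
      using i a_cases[of i] by (cases "x $ i") auto
    have pos: "\<beta> + q < \<rho>" if "a $ j = Pos \<beta>" "x $ j = Pos q" for j \<beta> q
      using \<rho>(2)[of SPos j "\<beta> + q"] that by simp
    show ?thesis
    proof (cases "i = m")
      case True
      then show ?thesis
        using \<alpha>p pos \<rho>(1) by (intro neg_m[OF x, of p]) (force simp: a_nth)+
    next
      case False
      have "\<exists>s. x $ m + Neg \<rho> = Neg s \<and> \<rho> \<le> s"
        using pos[of m 0] signed_spaceD[OF x, of m]
        by (cases "x $ m") (auto simp: a_nth not_less dest: less_imp_le)
      then obtain s where s: "x $ m + Neg \<rho> = Neg s" "\<rho> \<le> s"
        by blast
      define z where "z = (\<chi> k. if k = i then 0 else if k = m then Neg s else x $ k)"
      have z: "z \<in> signed_space"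
        using x by (auto simp: z_def intro: signed_spaceI)
      have "z \<notin> G"
      proof (rule neg_m[OF z])
        show "z $ m = Neg s" using False by (simp add: z_def)
        show "\<beta> + q < s" if "a $ j = Pos \<beta>" "z $ j = Pos q" for j \<beta> q
          using pos[of j \<beta> q] that s(2) by (simp add: z_def split: if_splits)
      qed
      moreover have "z \<in> G" if "x \<in> G"
        by (rule tc_closed_add[OF G_closed that swapped[OF False \<alpha>p(1), of \<rho> p], of _ i])
          (use x z False \<rho>(1) \<alpha>p s in \<open>auto simp: z_def\<close>)
      ultimately show ?thesis by blast
    qed
  qed
  show ?thesis
    using signed \<open>a \<noteq> 0\<close> pos neg by (intro bexI[of _ a]) (auto simp: trop_pos_def trop_neg_def)
qed

text \<open>\<open>above i j\<close> says that the coefficient of \<open>j\<close> relative to that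
  of \<open>i\<close> is not infinite. On the finite set \<open>J\<close> of free axes this is a
  total preorder, so it has a greatest element; the axes outside \<open>J\<close> lie below every
  free axis.\<close>

lemma ex_top_free_axis:
  assumes m0: "\<And>r. axis m0 (Neg r) \<notin> G"
  obtains m where "\<And>r. axis m (Neg r) \<notin> G" "\<And>j. j \<noteq> m \<Longrightarrow> \<exists>q. axis_pair m j 0 q \<in> G"
proof -
  define J where "J = {i. \<forall>r. axis i (Neg r) \<notin> G}"
  have free: "axis i (Neg r) \<notin> G" if "i \<in> J" for i r
    using that by (simp add: J_def)
  define above where "above = (\<lambda>i j. i = j \<or> (\<exists>q. axis_pair i j 0 q \<in> G))"
  have total: "above i j \<or> above j i" if "i \<in> J" "j \<in> J" for i j
  proof (rule ccontr)
    assume "\<not> (above i j \<or> above j i)"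
    \<comment> \<open>The norm \<open>- 1\<close> instead of 0 ensures that only coordinate
      \<open>j\<close> cancels while \<open>i\<close> stays positive.\<close>
    then have notin: "i \<noteq> j" "axis_pair i j 0 0 \<notin> G" "axis_pair j i 0 (- 1) \<notin> G"
      by (auto simp: above_def)
    have "axis i (Pos 0) \<in> signed_space - G"
      by (rule tc_closed_add[OF compl_closed, of "axis_pair i j 0 0" "axis_pair j i 0 (- 1)" _ j])
        (use notin in auto)
    then show False using axis_Pos_in by blast
  qed
  have trans: "above i k" if ij: "above i j" and jk: "above j k" and "j \<in> J" for i j k
  proof (cases "i = j \<or> j = k \<or> i = k")
    case False
    with ij jk obtain p q where p: "axis_pair i j 0 p \<in> G" and q: "axis_pair j k 0 q \<in> G"
      by (auto simp: above_def)
    \<comment> \<open>Scaling the second pair makes its entry at \<open>j\<close> opposite to that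
      of the first.\<close>
    have "axis_pair j k p (p + q) \<in> G"
      using q axis_pair_iff[OF free[OF \<open>j \<in> J\<close>], of k p "p + q"] by simp
    with p have "axis_pair i k 0 (p + q) \<in> G"
      by (rule tc_closed_add[OF G_closed, where i = j]) (use False in auto)
    then show ?thesis by (auto simp: above_def)
  qed (use ij jk in \<open>auto simp: above_def\<close>)
  have "\<exists>m\<in>F. \<forall>j\<in>F. above m j" if "finite F" "F \<noteq> {}" "F \<subseteq> J" for F
    using that
  proof (induction rule: finite_ne_induct)
    case (singleton i)
    then show ?case by (simp add: above_def)
  next
    case (insert k F)
    then obtain m where m: "m \<in> F" "\<forall>j\<in>F. above m j" by blast
    have J: "k \<in> J" "m \<in> J" using insert m by auto
    have refl: "above k k" by (simp add: above_def)
    show ?case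
    proof (cases "above m k")
      case True
      then show ?thesis using m by blast
    next
      case False
      then have "above k m" using total J by blast
      then have "\<forall>j\<in>F. above k j" using trans m J by blast
      then show ?thesis using refl by blast
    qed
  qed
  from this[of J] obtain m where m: "m \<in> J" "\<forall>j\<in>J. above m j"
    using m0 by (auto simp: J_def)
  show ?thesis
  proof
    show "axis m (Neg r) \<notin> G" for r using free m(1) by blast
    show "\<exists>q. axis_pair m j 0 q \<in> G" if "j \<noteq> m" for j
    proof (cases "j \<in> J")
      case True
      then show ?thesis using m(2) that by (auto simp: above_def)
    next
      case False
      then obtain q where q: "axis j (Neg q) \<in> G" by (auto simp: J_def)
      have "axis_pair m j 0 0 \<in> G"
      proof (rule ccontr)
        assume "axis_pair m j 0 0 \<notin> G"
        then have notin: "axis_pair m j q q \<notin> G"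
          using axis_pair_iff[OF free[OF m(1)], of j q q] by simp
        have "axis j (Neg q) \<in> signed_space - G"
          by (rule tc_closed_add[OF compl_closed, of "axis_pair m j q q" "axis m (Neg q)" _ m])
            (use notin free[OF m(1)] that in auto)
        then show False using q by blast
      qed
      then show ?thesis by blast
    qed
  qed
qed

text \<open>The linear part may vanish here, namely when \<open>G\<close> is the whole space;
  \<open>a \<noteq> 0\<close> is recovered at the very end.\<close>

lemma separating:
  "\<exists>a0\<in>trop_signed. \<exists>a\<in>signed_space. (a0 \<noteq> 0 \<or> a \<noteq> 0) \<and> (\<forall>x\<in>signed_space.
    (trop_affine a0 a x \<in> trop_pos \<longrightarrow> x \<in> G) \<and> (trop_affine a0 a x \<in> trop_neg \<longrightarrow> x \<notin> G))"
proof (cases "\<forall>i. \<exists>r. axis i (Neg r) \<in> G")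
  case True
  have "(1::symtrop) \<in> trop_signed" by (simp add: one_symtrop_def)
  with separating_bounded_axes True show ?thesis
    by (metis zero_neq_one)
next
  case False
  then obtain m0 where "\<And>r. axis m0 (Neg r) \<notin> G" by blast
  then obtain m where "\<And>r. axis m (Neg r) \<notin> G" "\<And>j. j \<noteq> m \<Longrightarrow> \<exists>q. axis_pair m j 0 q \<in> G"
    by (rule ex_top_free_axis) blast
  from separating_free_axis[OF this] show ?thesis
    by (metis trop_signed_simps(1))
qed

end

section \<open>Reduction by sign changes\<close>

definition flip :: "('d \<Rightarrow> tsign) \<Rightarrow> symtrop ^ 'd \<Rightarrow> symtrop ^ 'd" where
  "flip u x = (\<chi> i. Elem (u i) 0 * x $ i)"

lemma flip_nth [simp]: "flip u x $ i = Elem (u i) 0 * x $ i"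
  by (simp add: flip_def)

lemma flip_flip:
  assumes "\<And>i. u i \<noteq> SBal"
  shows "flip u (flip u x) = x"
proof -
  have "Elem (u i) 0 * Elem (u i) 0 = Pos 0" for i
    using assms[of i] by (cases "u i") auto
  then show ?thesis
    by (simp add: vec_eq_iff mult.assoc[symmetric] del: times_symtrop.simps)
qed

lemma flip_signed:
  assumes "\<And>i. u i \<noteq> SBal" "x \<in> signed_space"
  shows "flip u x \<in> signed_space"
  using assms by (auto intro!: signed_spaceI trop_signed_mult)

text \<open>Multiplication by a signed scalar distributes over sums and respects
  \<open>fills\<close>.\<close>

lemma tc_closed_flip:
  assumes X: "tc_closed X" and u: "\<And>i. u i \<noteq> SBal"
  shows "tc_closed {x \<in> signed_space. flip u x \<in> X}"
  unfolding tc_closed_def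
proof (intro ballI allI impI)
  fix x y z :: "symtrop ^ 'a" and p q :: real and i
  assume x: "x \<in> {x \<in> signed_space. flip u x \<in> X}" and y: "y \<in> {x \<in> signed_space. flip u x \<in> X}"
    and pq: "max p q = 0" and z: "z \<in> signed_space"
    and eq: "\<forall>j. j \<noteq> i \<longrightarrow> z $ j = Pos p * x $ j + Pos q * y $ j"
    and fi: "fills (z $ i) (Pos p * x $ i + Pos q * y $ i)"
  have "flip u z $ j = Pos p * flip u x $ j + Pos q * flip u y $ j" if "j \<noteq> i" for j
    using eq that by (simp add: distrib_left mult.left_commute)
  moreover have "fills (flip u z $ i) (Pos p * flip u x $ i + Pos q * flip u y $ i)"
    using fills_mult[OF fi, of "Elem (u i) 0"] u by (simp add: distrib_left mult.left_commute)
  ultimately have "flip u z \<in> X"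
    using X x y pq flip_signed[of u z, OF u z] unfolding tc_closed_def by blast
  then show "z \<in> {x \<in> signed_space. flip u x \<in> X}"
    using z by blast
qed

text \<open>Sign changes are self-adjoint, so they can be moved from the points to the
  coefficients.\<close>

lemma trop_affine_flip: "trop_affine a0 (flip u a) x = trop_affine a0 a (flip u x)"
  by (simp add: trop_affine_def ac_simps)

text \<open>On each axis one of the two open half-axes lies entirely in \<open>G\<close>, since
  otherwise two opposite points of the complement would cancel to the origin. Flipping signs makes
  these half-axes positive.\<close>

lemma separating_zero_in:
  fixes G :: "(symtrop ^ 'd) set"
  assumes sub: "G \<subseteq> signed_space" and G: "tc_closed G" and H: "tc_closed (signed_space - G)"
    and zero: "0 \<in> G"
  shows "\<exists>a0\<in>trop_signed. \<exists>a\<in>signed_space. (a0 \<noteq> 0 \<or> a \<noteq> 0) \<and> (\<forall>x\<in>signed_space.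
    (trop_affine a0 a x \<in> trop_pos \<longrightarrow> x \<in> G) \<and> (trop_affine a0 a x \<in> trop_neg \<longrightarrow> x \<notin> G))"
proof -
  have "\<exists>u. u \<noteq> SBal \<and> (\<forall>r. axis i (Elem u r) \<in> G)" for i
  proof (rule ccontr)
    assume "\<not> ?thesis"
    then obtain r s where "axis i (Pos r) \<in> signed_space - G" "axis i (Neg s) \<in> signed_space - G"
      using signed_space_simps(2) by (metis DiffI trop_signed_simps(2) tsign.distinct(3,5))
    note notin = this
    have "0 \<in> signed_space - G"
    \<comment> \<open>Only nonpositive scaling exponents are available, so the point of larger norm
      is scaled down to the other.\<close>
    proof (cases "s \<le> r")
      case True
      with notin show ?thesis
        by - (rule tc_closed_scale_add[OF H, where p = "s - r" and i = i], assumption+, auto)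
    next
      case False
      with notin(2,1) show ?thesis
        by - (rule tc_closed_scale_add[OF H, where p = "r - s" and i = i], assumption+, auto)
    qed
    then show False using zero by blast
  qed
  then obtain u where u: "\<And>i. u i \<noteq> SBal" "\<And>i r. axis i (Elem (u i) r) \<in> G"
    by metis
  have flip_sp: "flip u x \<in> signed_space" if "x \<in> signed_space" for x
    using u(1) that by (rule flip_signed)
  define G' where "G' = {x \<in> signed_space. flip u x \<in> G}"
  have flip_axis: "flip u (axis i (Pos r)) = axis i (Elem (u i) r)" for i r
    by (simp add: vec_eq_iff)
  have compl: "signed_space - G' = {x \<in> signed_space. flip u x \<in> signed_space - G}"
    using flip_sp by (auto simp: G'_def)
  have "flip u 0 = 0" by (simp add: vec_eq_iff)
  then interpret orthant_hemispace G'
    using tc_closed_flip[OF G u(1)] tc_closed_flip[OF H u(1)] u(2) zero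
    by unfold_locales (auto simp: compl flip_axis, auto simp: G'_def flip_axis)
  obtain a0 a where a: "a0 \<in> trop_signed" "a \<in> signed_space" "a0 \<noteq> 0 \<or> a \<noteq> 0"
    "\<And>x. x \<in> signed_space \<Longrightarrow> trop_affine a0 a x \<in> trop_pos \<Longrightarrow> x \<in> G'"
    "\<And>x. x \<in> signed_space \<Longrightarrow> trop_affine a0 a x \<in> trop_neg \<Longrightarrow> x \<notin> G'"
    using separating by blast
  have G'_iff: "flip u x \<in> G' \<longleftrightarrow> x \<in> G" if "x \<in> signed_space" for x
    using that flip_sp[of x] flip_flip[of u x, OF u(1)] by (simp add: G'_def)
  have "a0 \<noteq> 0 \<or> flip u a \<noteq> 0"
    using a(3) flip_flip[of u a, OF u(1)] \<open>flip u 0 = 0\<close> by metis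
  then show ?thesis
    using a flip_sp G'_iff
    by (intro bexI[of _ a0] bexI[of _ "flip u a"]) (auto simp: trop_affine_flip)
qed

text \<open>The hypotheses are symmetric in \<open>G\<close> and its complement. If the origin is
  outside \<open>G\<close>, the complement is separated and all coefficients are negated.\<close>

lemma separating_hemispace:
  fixes G :: "(symtrop ^ 'd) set"
  assumes sub: "G \<subseteq> signed_space" and G: "tc_closed G" and H: "tc_closed (signed_space - G)"
  shows "\<exists>a0\<in>trop_signed. \<exists>a\<in>signed_space. (a0 \<noteq> 0 \<or> a \<noteq> 0) \<and> (\<forall>x\<in>signed_space.
    (trop_affine a0 a x \<in> trop_pos \<longrightarrow> x \<in> G) \<and> (trop_affine a0 a x \<in> trop_neg \<longrightarrow> x \<notin> G))"
proof (cases "0 \<in> G")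
  case True
  then show ?thesis using separating_zero_in assms by blast
next
  case False
  have "signed_space - (signed_space - G) = G" using sub by blast
  with separating_zero_in[of "signed_space - G"] G H False
  obtain a0 a where a: "a0 \<in> trop_signed" "a \<in> signed_space" "a0 \<noteq> 0 \<or> a \<noteq> 0"
    "\<And>x. x \<in> signed_space \<Longrightarrow> trop_affine a0 a x \<in> trop_pos \<Longrightarrow> x \<notin> G"
    "\<And>x. x \<in> signed_space \<Longrightarrow> trop_affine a0 a x \<in> trop_neg \<Longrightarrow> x \<in> G"
    by auto
  define b0 where "b0 = Neg 0 * a0"
  define b where "b = flip (\<lambda>_. SNeg) a"
  have affine: "trop_affine b0 b x = Neg 0 * trop_affine a0 a x" for x
    by (simp add: b0_def b_def trop_affine_def distrib_left sum_distrib_left mult.assoc)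
  have neg_iff: "Neg 0 * s \<in> trop_pos \<longleftrightarrow> s \<in> trop_neg" "Neg 0 * s \<in> trop_neg \<longleftrightarrow> s \<in> trop_pos"
    for s by (cases s; simp)+
  have "b0 \<noteq> 0 \<or> b \<noteq> 0"
  proof -
    have "b0 = 0 \<longleftrightarrow> a0 = 0"
      unfolding b0_def by (cases a0) auto
    moreover have "flip (\<lambda>_. SNeg) b = a"
      unfolding b_def by (rule flip_flip) simp
    moreover have "flip (\<lambda>_. SNeg) 0 = (0 :: symtrop ^ 'd)"
      by (simp add: vec_eq_iff)
    ultimately show ?thesis using a(3) by metis
  qed
  moreover have "b0 \<in> trop_signed" "b \<in> signed_space"
    using a(1,2) by (auto simp: b0_def b_def intro!: trop_signed_mult flip_signed)
  ultimately show ?thesis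
    using a(4,5) by (intro bexI[of _ b0] bexI[of _ b]) (auto simp: affine neg_iff)
qed

theorem theorem4p3:
  fixes G :: "(symtrop ^ 'd) set"
  assumes "TC_hemispace G"
    and "G \<notin> {{}, signed_space}"
  shows "\<exists>a0 a. a0 \<in> trop_signed \<and> a \<in> signed_space \<and> a \<noteq> 0 \<and>
    open_halfspace a0 a \<subseteq> G \<and> G \<subseteq> closed_halfspace a0 a"
proof -
  have sub: "G \<subseteq> signed_space"
    and closed: "tc_closed G" "tc_closed (signed_space - G)"
    using assms(1) TC_convex_imp_tc_closed by (auto simp: TC_hemispace_def TC_convex_def)
  from separating_hemispace[OF this]
  obtain a0 a where a: "a0 \<in> trop_signed" "a \<in> signed_space" "a0 \<noteq> 0 \<or> a \<noteq> 0"
    and pos: "\<And>x. x \<in> signed_space \<Longrightarrow> trop_affine a0 a x \<in> trop_pos \<Longrightarrow> x \<in> G"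
    and neg: "\<And>x. x \<in> signed_space \<Longrightarrow> trop_affine a0 a x \<in> trop_neg \<Longrightarrow> x \<notin> G"
    by blast
  \<comment> \<open>Otherwise the affine form is a nonzero signed constant, whose sign forces
    \<open>G\<close> to be empty or everything.\<close>
  have "a \<noteq> 0"
  proof
    assume "a = 0"
    then have const: "trop_affine a0 a x = a0" for x
      by (simp add: trop_affine_def)
    from a(1,3) \<open>a = 0\<close> have "a0 \<in> trop_pos \<or> a0 \<in> trop_neg"
      by (auto simp: trop_signed_def)
    then have "G = signed_space \<or> G = {}"
      using pos neg sub unfolding const by blast
    then show False using assms(2) by blast
  qed
  moreover have "open_halfspace a0 a \<subseteq> G"
    using pos by (auto simp: open_halfspace_def)
  moreover have "G \<subseteq> closed_halfspace a0 a"
  proof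
    fix x assume "x \<in> G"
    then have "x \<in> signed_space" "trop_affine a0 a x \<notin> trop_neg"
      using sub neg by blast+
    then show "x \<in> closed_halfspace a0 a"
      by (cases "trop_affine a0 a x") (auto simp: closed_halfspace_def)
  qed
  ultimately show ?thesis using a by blast
qed

end
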